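(* Let $\mathbb{F}=\mathbb{R}$ or $\mathbb{F}=\mathbb{C}$. For an arbitrary $w\in\mathbb{F}$ with $|w|>1$, the bounded linear weighted backward shift operator \[ c(\mathbb{N})\ni x=(x_k)_{k\in\mathbb{N}}\mapsto A_wx:=w\,(x_{k+1})_{k\in\mathbb{N}}\in c(\mathbb{N}) \] on the space $c(\mathbb{N})$ is not hypercyclic.
   Context: $\mathbb{N}=\{1,2,3,\dots\}$, $\mathbb{Z}_+=\{0,1,2,\dots\}$. $c(\mathbb{N})$ is the Banach space of $\mathbb{F}$-valued sequences $(x_k)_{k\in\mathbb{N}}$ for which $\lim_{k\to\infty}x_k$ exists in $\mathbb{F}$, with the norm $\|x\|_\infty=\sup_{k\in\mathbb{N}}|x_k|$. For a (bounded or unbounded) linear operator $A$ with domain $D(A)$ in a real or complex Banach space $X$, put $A^0:=I$ and $C^\infty(A):=\bigcap_{n=0}^\infty D(A^n)$. A nonzero vector $x\in C^\infty(A)$ is hypercyclic for $A$ if its orbit $\{A^nx\}_{n\in\mathbb{Z}_+}$ is dense in $X$; $A$ is hypercyclic if it possesses a hypercyclic vector. *)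

theory Defs
  imports "HOL-Analysis.Analysis"
begin

section \<open>Hypercyclic operators\<close>

text \<open>
  An operator with domain \<open>D\<close> is given by the set \<open>D\<close> and a total function \<open>A\<close> whose values
  outside \<open>D\<close> are irrelevant: \<open>op_pow_dom D A n\<close> is the domain of the \<open>n\<close>-th power of that operator,
  and \<open>A ^^ n\<close> is only looked at on this set. A complex Banach space is in particular a real one, so
  the sort \<open>banach\<close> covers both scalar fields; linearity plays no role in the definition of
  hypercyclicity itself.
\<close>

primrec op_pow_dom :: "'x set \<Rightarrow> ('x \<Rightarrow> 'x) \<Rightarrow> nat \<Rightarrow> 'x set" where
  "op_pow_dom D A 0 = UNIV"
| "op_pow_dom D A (Suc n) = {x \<in> op_pow_dom D A n. (A ^^ n) x \<in> D}"

definition C_infty :: "'x set \<Rightarrow> ('x \<Rightarrow> 'x) \<Rightarrow> 'x set" where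
  "C_infty D A = (\<Inter>n. op_pow_dom D A n)"

definition hypercyclic_vector :: "'x::banach set \<Rightarrow> ('x \<Rightarrow> 'x) \<Rightarrow> 'x \<Rightarrow> bool" where
  "hypercyclic_vector D A x \<longleftrightarrow>
     x \<noteq> 0 \<and> x \<in> C_infty D A \<and> closure (range (\<lambda>n. (A ^^ n) x)) = UNIV"

definition hypercyclic :: "'x::banach set \<Rightarrow> ('x \<Rightarrow> 'x) \<Rightarrow> bool" where
  "hypercyclic D A \<longleftrightarrow> (\<exists>x. hypercyclic_vector D A x)"

text \<open>
  Bounded linear operators with respect to an explicit scalar multiplication; the library's
  \<open>bounded_linear\<close> only knows about real scalars.
\<close>

definition bounded_linear_over ::
    "('a::field \<Rightarrow> 'x::real_normed_vector \<Rightarrow> 'x) \<Rightarrow> ('x \<Rightarrow> 'x) \<Rightarrow> bool" where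
  "bounded_linear_over scl A \<longleftrightarrow>
     Vector_Spaces.linear scl scl A \<and> (\<exists>K. \<forall>x. norm (A x) \<le> K * norm x)"

section \<open>The space of convergent sequences\<close>

text \<open>
  Sequences are indexed from 0: \<open>cs_nth x k\<close> is the \<open>(k + 1)\<close>-st term of \<open>x\<close>.
\<close>

typedef (overloaded) 'a conv_seq = "{x :: nat \<Rightarrow> 'a::real_normed_vector. convergent x}"
  morphisms cs_nth Conv_seq
  by (auto intro: convergent_const)

setup_lifting type_definition_conv_seq

lemma convergent_cs_nth: "convergent (cs_nth x)"
  using cs_nth[of x] by simp

lemma conv_seq_eqI: "(\<And>k. cs_nth x k = cs_nth y k) \<Longrightarrow> x = y"
  by (metis cs_nth_inject ext)

lemma bdd_above_cs_nth: "bdd_above (range (\<lambda>k. norm (cs_nth x k)))"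
proof -
  have "Bseq (cs_nth x)"
    by (rule convergent_imp_Bseq[OF convergent_cs_nth])
  then show ?thesis
    by (auto simp: Bseq_def bdd_above_def)
qed

instantiation conv_seq :: (real_normed_vector) real_normed_vector
begin

lift_definition zero_conv_seq :: "'a conv_seq" is "\<lambda>_. 0"
  by (rule convergent_const)

lift_definition plus_conv_seq :: "'a conv_seq \<Rightarrow> 'a conv_seq \<Rightarrow> 'a conv_seq"
  is "\<lambda>x y k. x k + y k"
  by (rule convergent_add)

lift_definition uminus_conv_seq :: "'a conv_seq \<Rightarrow> 'a conv_seq" is "\<lambda>x k. - x k"
  by (simp add: convergent_minus_iff[symmetric])

lift_definition minus_conv_seq :: "'a conv_seq \<Rightarrow> 'a conv_seq \<Rightarrow> 'a conv_seq"
  is "\<lambda>x y k. x k - y k"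
  by (rule convergent_diff)

lift_definition scaleR_conv_seq :: "real \<Rightarrow> 'a conv_seq \<Rightarrow> 'a conv_seq"
  is "\<lambda>r x k. r *\<^sub>R x k"
  unfolding convergent_def by (blast intro: tendsto_scaleR[OF tendsto_const])

definition norm_conv_seq :: "'a conv_seq \<Rightarrow> real" where
  "norm_conv_seq x = (SUP k. norm (cs_nth x k))"

definition dist_conv_seq :: "'a conv_seq \<Rightarrow> 'a conv_seq \<Rightarrow> real" where
  "dist_conv_seq x y = norm (x - y)"

definition sgn_conv_seq :: "'a conv_seq \<Rightarrow> 'a conv_seq" where
  "sgn_conv_seq x = inverse (norm x) *\<^sub>R x"

definition uniformity_conv_seq :: "('a conv_seq \<times> 'a conv_seq) filter" where
  "uniformity_conv_seq = (INF e\<in>{0<..}. principal {(x, y). dist x y < e})"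

definition open_conv_seq :: "'a conv_seq set \<Rightarrow> bool" where
  "open_conv_seq U = (\<forall>x\<in>U. \<forall>\<^sub>F (x', y) in uniformity. x' = x \<longrightarrow> y \<in> U)"

lemma norm_cs_nth_le: "norm (cs_nth x k) \<le> norm x"
  unfolding norm_conv_seq_def by (rule cSUP_upper[OF UNIV_I bdd_above_cs_nth])

lemma norm_conv_seq_le: "(\<And>k. norm (cs_nth x k) \<le> B) \<Longrightarrow> norm x \<le> B"
  unfolding norm_conv_seq_def by (rule cSUP_least) auto

instance
proof
  fix a b :: real and x y z :: "'a conv_seq"
  show "x + y + z = x + (y + z)" "x + y = y + x" "0 + x = x" "- x + x = 0" "x - y = x + - y"
    by (transfer; simp add: algebra_simps)+
  show "a *\<^sub>R (x + y) = a *\<^sub>R x + a *\<^sub>R y" "(a + b) *\<^sub>R x = a *\<^sub>R x + b *\<^sub>R x"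
    "a *\<^sub>R b *\<^sub>R x = (a * b) *\<^sub>R x" "1 *\<^sub>R x = x"
    by (transfer; simp add: algebra_simps)+
  show "dist x y = norm (x - y)" by (rule dist_conv_seq_def)
  show "sgn x = inverse (norm x) *\<^sub>R x" by (rule sgn_conv_seq_def)
  show "uniformity = (INF e\<in>{0<..}. principal {(x :: 'a conv_seq, y). dist x y < e})"
    by (rule uniformity_conv_seq_def)
  show "open U = (\<forall>x\<in>U. \<forall>\<^sub>F (x', y) in uniformity. x' = x \<longrightarrow> y \<in> U)" for U :: "'a conv_seq set"
    by (rule open_conv_seq_def)
  show "norm x = 0 \<longleftrightarrow> x = 0"
  proof
    assume "norm x = 0"
    then have "cs_nth x k = 0" for k
      using norm_cs_nth_le[of x k] by simp
    then show "x = 0"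
      by (intro conv_seq_eqI) (simp add: zero_conv_seq.rep_eq)
  next
    assume "x = 0"
    then show "norm x = 0"
      by (simp add: norm_conv_seq_def zero_conv_seq.rep_eq)
  qed
  show "norm (x + y) \<le> norm x + norm y"
  proof (rule norm_conv_seq_le)
    fix k
    have "norm (cs_nth x k + cs_nth y k) \<le> norm (cs_nth x k) + norm (cs_nth y k)"
      by (rule norm_triangle_ineq)
    also have "\<dots> \<le> norm x + norm y"
      by (intro add_mono norm_cs_nth_le)
    finally show "norm (cs_nth (x + y) k) \<le> norm x + norm y"
      by (simp add: plus_conv_seq.rep_eq)
  qed
  have le: "norm (c *\<^sub>R v) \<le> \<bar>c\<bar> * norm v" for c :: real and v :: "'a conv_seq"
    by (rule norm_conv_seq_le) (simp add: scaleR_conv_seq.rep_eq mult_left_mono norm_cs_nth_le)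
  show "norm (a *\<^sub>R x) = \<bar>a\<bar> * norm x"
  proof (cases "a = 0")
    case True
    then show ?thesis
      by (simp add: norm_conv_seq_def scaleR_conv_seq.rep_eq)
  next
    case False
    have "inverse a *\<^sub>R (a *\<^sub>R x) = x"
      using False by transfer simp
    then have "norm x \<le> \<bar>inverse a\<bar> * norm (a *\<^sub>R x)"
      using le[of "inverse a" "a *\<^sub>R x"] by simp
    then have "\<bar>a\<bar> * norm x \<le> norm (a *\<^sub>R x)"
      using False by (simp add: field_simps)
    with le[of a x] show ?thesis by simp
  qed
qed

end

instance conv_seq :: (banach) banach
proof
  fix X :: "nat \<Rightarrow> 'a conv_seq"
  assume X: "Cauchy X"
  have nth_dist: "dist (cs_nth x k) (cs_nth y k) \<le> dist x y" for x y :: "'a conv_seq" and k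
    using norm_cs_nth_le[of "x - y" k] by (simp add: dist_norm minus_conv_seq.rep_eq)
  have "Cauchy (\<lambda>n. cs_nth (X n) k)" for k
    using X unfolding Cauchy_def by (meson nth_dist le_less_trans)
  then have "\<exists>l. (\<lambda>n. cs_nth (X n) k) \<longlonglongrightarrow> l" for k
    using Cauchy_convergent convergent_def by blast
  then obtain l where l: "(\<lambda>n. cs_nth (X n) k) \<longlonglongrightarrow> l k" for k
    by metis
  have unif: "\<exists>N. \<forall>n\<ge>N. \<forall>k. dist (cs_nth (X n) k) (l k) \<le> e" if e: "e > 0" for e
  proof -
    obtain N where N: "\<And>m n. m \<ge> N \<Longrightarrow> n \<ge> N \<Longrightarrow> dist (X m) (X n) < e"
      using metric_CauchyD[OF X e] by blast
    have "dist (cs_nth (X n) k) (l k) \<le> e" if "n \<ge> N" for n k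
    proof (rule LIMSEQ_le_const2)
      show "(\<lambda>m. dist (cs_nth (X n) k) (cs_nth (X m) k)) \<longlonglongrightarrow> dist (cs_nth (X n) k) (l k)"
        by (intro tendsto_intros l)
      show "\<exists>M. \<forall>m\<ge>M. dist (cs_nth (X n) k) (cs_nth (X m) k) \<le> e"
        using N that nth_dist by (meson le_less_trans less_imp_le)
    qed
    then show ?thesis by blast
  qed
  have "Cauchy l"
  proof (rule metric_CauchyI)
    fix e :: real
    assume e: "e > 0"
    obtain n where n: "\<And>k. dist (cs_nth (X n) k) (l k) \<le> e / 4"
      using unif[of "e / 4"] e by auto
    have "Cauchy (cs_nth (X n))"
      by (rule convergent_Cauchy[OF convergent_cs_nth])
    then obtain M where M: "\<And>i j. i \<ge> M \<Longrightarrow> j \<ge> M \<Longrightarrow>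
        dist (cs_nth (X n) i) (cs_nth (X n) j) < e / 2"
      using metric_CauchyD[of "cs_nth (X n)" "e / 2"] e by auto
    have "dist (l i) (l j) < e" if "i \<ge> M" "j \<ge> M" for i j
    proof -
      have "dist (l i) (l j) \<le> dist (l i) (cs_nth (X n) i) + dist (cs_nth (X n) i) (l j)"
        by (rule dist_triangle)
      also have "dist (cs_nth (X n) i) (l j) \<le>
          dist (cs_nth (X n) i) (cs_nth (X n) j) + dist (cs_nth (X n) j) (l j)"
        by (rule dist_triangle)
      finally show ?thesis
        using n[of i] n[of j] M[OF that] by (simp add: dist_commute)
    qed
    then show "\<exists>M. \<forall>m\<ge>M. \<forall>n\<ge>M. dist (l m) (l n) < e" by blast
  qed
  then have "convergent l"
    by (rule Cauchy_convergent)
  then have L: "cs_nth (Conv_seq l) = l"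
    by (simp add: Conv_seq_inverse)
  have "X \<longlonglongrightarrow> Conv_seq l"
  proof (rule metric_LIMSEQ_I)
    fix e :: real
    assume e: "e > 0"
    obtain N where N: "\<And>n k. n \<ge> N \<Longrightarrow> dist (cs_nth (X n) k) (l k) \<le> e / 2"
      using unif[of "e / 2"] e by auto
    have "dist (X n) (Conv_seq l) < e" if "n \<ge> N" for n
    proof -
      have "norm (X n - Conv_seq l) \<le> e / 2"
        by (rule norm_conv_seq_le)
          (use N[OF that] in \<open>simp add: minus_conv_seq.rep_eq L dist_norm\<close>)
      then show ?thesis using e by (simp add: dist_norm)
    qed
    then show "\<exists>N. \<forall>n\<ge>N. dist (X n) (Conv_seq l) < e" by blast
  qed
  then show "convergent X"
    by (auto simp: convergent_def)
qed

lift_definition cs_scale :: "'a::real_normed_field \<Rightarrow> 'a conv_seq \<Rightarrow> 'a conv_seq"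
  is "\<lambda>c x k. c * x k"
  by (auto simp: convergent_def intro: tendsto_mult_left)

lemma vector_space_cs_scale: "vector_space cs_scale"
  by unfold_locales (transfer; simp add: algebra_simps)+

lemma cs_scale_of_real: "cs_scale (of_real r) x = r *\<^sub>R x"
  by transfer (simp add: scaleR_conv_of_real)

lemma norm_cs_scale_le: "norm (cs_scale c x) \<le> norm c * norm x"
  by (rule norm_conv_seq_le)
    (simp add: cs_scale.rep_eq norm_mult mult_left_mono norm_cs_nth_le)

lemma norm_cs_scale: "norm (cs_scale c x) = norm c * norm x"
proof (cases "c = 0")
  case True
  then show ?thesis
    using norm_cs_scale_le[of c x] by simp
next
  case False
  have "cs_scale (inverse c) (cs_scale c x) = x"
    using False by transfer (simp add: mult.assoc[symmetric])
  then have "norm x \<le> norm (inverse c) * norm (cs_scale c x)"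
    using norm_cs_scale_le[of "inverse c" "cs_scale c x"] by simp
  then have "norm c * norm x \<le> norm (cs_scale c x)"
    using False by (simp add: norm_divide field_simps)
  with norm_cs_scale_le[of c x] show ?thesis by simp
qed

section \<open>Weighted backward shifts\<close>

lift_definition weighted_shift :: "'a::real_normed_field \<Rightarrow> 'a conv_seq \<Rightarrow> 'a conv_seq"
  is "\<lambda>w x k. w * x (Suc k)"
  by (auto simp: convergent_def intro!: tendsto_mult_left LIMSEQ_Suc)

end

theory Submission
  imports Defs
begin

text \<open>
  The limit functional \<open>L x = lim x\<close> is a nonzero continuous linear functional on the space of
  convergent sequences, and it is an eigenvector of the adjoint of the shift \<open>A\<close> with weight \<open>w\<close>,
  because dropping the first term does not change a limit: \<open>L (A x) = w * L x\<close>. Hence the numbers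
  \<open>L (A\<^sup>n x) = w\<^sup>n * L x\<close> are either all zero or, if \<open>w\<close> has norm at least \<open>1\<close>, bounded away from
  zero. A dense orbit would make these numbers dense in the range of \<open>L\<close>, which contains both \<open>0\<close>
  and nonzero values. On the space of null sequences \<open>L\<close> vanishes, and there the shifts with
  \<open>norm w > 1\<close> are indeed hypercyclic.
\<close>

text \<open>
  If \<open>L x \<noteq> 0\<close> the orbit stays in the closed set \<open>norm (L y) \<ge> norm (L x)\<close>, which misses \<open>0\<close>;
  if \<open>L x = 0\<close> it stays in the closed kernel of \<open>L\<close>, which is proper.
\<close>

lemma not_hypercyclic_if_adjoint_eigenvector:
  fixes L :: "'x::banach \<Rightarrow> 'a::real_normed_field"
  assumes L: "bounded_linear L"
    and nonzero: "L z \<noteq> 0"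
    and eigen: "\<And>x. x \<in> D \<Longrightarrow> L (A x) = w * L x"
    and w: "norm w \<ge> 1"
  shows "\<not> hypercyclic D A"
proof
  assume "hypercyclic D A"
  then obtain x where dom: "x \<in> C_infty D A"
    and dense: "closure (range (\<lambda>n. (A ^^ n) x)) = UNIV"
    by (auto simp: hypercyclic_def hypercyclic_vector_def)
  have in_D: "(A ^^ n) x \<in> D" for n
  proof -
    have "x \<in> op_pow_dom D A (Suc n)"
      using dom unfolding C_infty_def by blast
    then show ?thesis by simp
  qed
  have orbit: "L ((A ^^ n) x) = w ^ n * L x" for n
    by (induction n) (simp_all add: eigen[OF in_D])
  have everywhere: "L y \<in> S" if "closed S" "\<And>n. w ^ n * L x \<in> S" for S y
  proof -
    have "closed (L -` S)"
      by (rule closed_vimage[OF that(1) linear_continuous_on[OF L]])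
    moreover have "range (\<lambda>n. (A ^^ n) x) \<subseteq> L -` S"
      using that(2) orbit by auto
    ultimately have "closure (range (\<lambda>n. (A ^^ n) x)) \<subseteq> L -` S"
      by (rule closure_minimal[rotated])
    then show ?thesis
      using dense by auto
  qed
  show False
  proof (cases "L x = 0")
    case True
    then show False
      using everywhere[of "{0}" z] nonzero by simp
  next
    case False
    have "norm (L x) \<le> norm (w ^ n * L x)" for n
      using mult_right_mono[OF one_le_power[OF w, of n], of "norm (L x)"]
      by (simp add: norm_mult norm_power)
    moreover have "closed {c :: 'a. norm (L x) \<le> norm c}"
      by (intro closed_Collect_le continuous_intros)
    ultimately have "norm (L x) \<le> norm (L 0)"
      using everywhere[of "{c. norm (L x) \<le> norm c}" 0] by simp
    then show False
      using False linear_0[OF bounded_linear.linear[OF L]] by simp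
  qed
qed

lemma cs_nth_tendsto_lim: "cs_nth x \<longlonglongrightarrow> lim (cs_nth x)"
  using convergent_cs_nth by (simp add: convergent_LIMSEQ_iff)

lemma bounded_linear_lim_cs_nth:
  "bounded_linear (\<lambda>x :: 'a::real_normed_vector conv_seq. lim (cs_nth x))"
proof (rule bounded_linear_intro)
  fix x y :: "'a conv_seq" and r :: real
  show "lim (cs_nth (x + y)) = lim (cs_nth x) + lim (cs_nth y)"
    unfolding plus_conv_seq.rep_eq by (intro limI tendsto_add cs_nth_tendsto_lim)
  show "lim (cs_nth (r *\<^sub>R x)) = r *\<^sub>R lim (cs_nth x)"
    unfolding scaleR_conv_seq.rep_eq
    by (intro limI tendsto_scaleR tendsto_const cs_nth_tendsto_lim)
  show "norm (lim (cs_nth x)) \<le> norm x * 1"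
    using LIMSEQ_le_const2[OF tendsto_norm[OF cs_nth_tendsto_lim[of x]], of "norm x"]
    by (simp add: norm_cs_nth_le)
qed

lemma lim_weighted_shift: "lim (cs_nth (weighted_shift w x)) = w * lim (cs_nth x)"
  unfolding weighted_shift.rep_eq
  by (intro limI tendsto_mult_left LIMSEQ_Suc cs_nth_tendsto_lim)

lemma bounded_linear_over_weighted_shift:
  fixes w :: "'a::real_normed_field"
  shows "bounded_linear_over cs_scale (weighted_shift w)"
proof -
  interpret vector_space "cs_scale :: 'a \<Rightarrow> _"
    by (rule vector_space_cs_scale)
  have "Vector_Spaces.linear cs_scale cs_scale (weighted_shift w)"
    by unfold_locales (transfer; simp add: algebra_simps)+
  moreover have "norm (weighted_shift w x) \<le> norm w * norm x" for x
    by (rule norm_conv_seq_le)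
      (simp add: weighted_shift.rep_eq norm_mult mult_left_mono norm_cs_nth_le)
  ultimately show ?thesis
    unfolding bounded_linear_over_def by blast
qed

lemma not_hypercyclic_weighted_shift:
  fixes w :: "'a::{real_normed_field,banach}"
  assumes "norm w \<ge> 1"
  shows "\<not> hypercyclic UNIV (weighted_shift w)"
proof (rule not_hypercyclic_if_adjoint_eigenvector)
  show "bounded_linear (\<lambda>x :: 'a conv_seq. lim (cs_nth x))"
    by (rule bounded_linear_lim_cs_nth)
  show "lim (cs_nth (Conv_seq (\<lambda>_. 1 :: 'a))) \<noteq> 0"
    by (simp add: Conv_seq_inverse convergent_const)
qed (use assms in \<open>simp_all add: lim_weighted_shift\<close>)

theorem proposition4p1:
  shows "(\<forall>w::real. norm w > 1 \<longrightarrow>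
            bounded_linear_over cs_scale (weighted_shift w) \<and>
            \<not> hypercyclic UNIV (weighted_shift w)) \<and>
         (\<forall>w::complex. norm w > 1 \<longrightarrow>
            bounded_linear_over cs_scale (weighted_shift w) \<and>
            \<not> hypercyclic UNIV (weighted_shift w))"
  by (intro conjI allI impI bounded_linear_over_weighted_shift not_hypercyclic_weighted_shift
      less_imp_le)

end
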